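(* Let $J=\{j_1,j_2,\ldots,j_k\}\subset\mathbb{Z}^+$ with $1\le j_1<j_2<\cdots<j_k$, and let $n$ be a positive integer such that the circulant graph $\mathrm{Ci}_n(J)$ is connected. Then \[\operatorname{gon}(\mathrm{Ci}_n(J))\le 2\sum_{\alpha=1}^{k} j_\alpha^2.\]
   Context: For a positive integer $n$ and $J\subset\{1,\ldots,\lfloor n/2\rfloor\}$, the circulant graph $\mathrm{Ci}_n(J)$ has vertices $v_1,\ldots,v_n$, with $v_i$ adjacent to $v_m$ if and only if $|i-m| \bmod n\in J$. For a connected loopless multigraph $G$: a divisor is a function $D:V(G)\to\mathbb{Z}$ (number of chips on each vertex); it is effective if $D(v)\ge 0$ for all $v$; its degree is $\sum_v D(v)$. Firing a vertex $v$ moves one chip from $v$ along each edge incident to $v$ to its other endpoint; two divisors are equivalent if one is obtained from the other by a sequence of such firings. A divisor $D$ has positive rank if for every vertex $q$, $D-q$ is equivalent to an effective divisor. The (divisorial) gonality $\operatorname{gon}(G)$ is the minimum degree of a positive rank divisor on $G$. *)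

theory Defs
  imports "Graph_Theory.Graph_Theory"
begin

section \<open>Chip-firing on multigraphs\<close>

text \<open>
  An undirected loopless multigraph is represented by a digraph (in the sense of
  \<^typ>\<open>('a, 'b) pre_digraph\<close>) in which every undirected edge is a pair of opposite arcs.
  Thus the edges incident to \<open>v\<close> are the arcs with tail \<open>v\<close>, and the head of such an arc
  is the other endpoint of the edge.
\<close>

text \<open>Divisors are functions on the vertex set; as total functions they vanish elsewhere.\<close>

definition is_divisor :: "('a, 'b) pre_digraph \<Rightarrow> ('a \<Rightarrow> int) \<Rightarrow> bool" where
  "is_divisor G D \<longleftrightarrow> (\<forall>v. v \<notin> verts G \<longrightarrow> D v = 0)"

definition effective :: "('a, 'b) pre_digraph \<Rightarrow> ('a \<Rightarrow> int) \<Rightarrow> bool" where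
  "effective G D \<longleftrightarrow> (\<forall>v \<in> verts G. D v \<ge> 0)"

definition divisor_degree :: "('a, 'b) pre_digraph \<Rightarrow> ('a \<Rightarrow> int) \<Rightarrow> int" where
  "divisor_degree G D = (\<Sum>v \<in> verts G. D v)"

definition fire :: "('a, 'b) pre_digraph \<Rightarrow> 'a \<Rightarrow> ('a \<Rightarrow> int) \<Rightarrow> 'a \<Rightarrow> int" where
  "fire G v D = (\<lambda>u. D u
      - (if u = v then int (out_degree G v) else 0)
      + int (card {e \<in> out_arcs G v. head G e = u}))"

definition fires_to :: "('a, 'b) pre_digraph \<Rightarrow> ('a \<Rightarrow> int) \<Rightarrow> ('a \<Rightarrow> int) \<Rightarrow> bool" where
  "fires_to G D D' \<longleftrightarrow> (\<exists>v \<in> verts G. D' = fire G v D)"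

text \<open>
  On a finite undirected multigraph firing every vertex once leaves a divisor unchanged, so a
  firing can be undone by firings and the following relation is symmetric.
\<close>

definition equivalent :: "('a, 'b) pre_digraph \<Rightarrow> ('a \<Rightarrow> int) \<Rightarrow> ('a \<Rightarrow> int) \<Rightarrow> bool" where
  "equivalent G D D' \<longleftrightarrow> (fires_to G)\<^sup>*\<^sup>* D D'"

definition positive_rank :: "('a, 'b) pre_digraph \<Rightarrow> ('a \<Rightarrow> int) \<Rightarrow> bool" where
  "positive_rank G D \<longleftrightarrow>
     (\<forall>q \<in> verts G. \<exists>E. is_divisor G E \<and> effective G E \<and> equivalent G (D(q := D q - 1)) E)"

text \<open>The minimum exists on every finite nonempty graph, see \<open>gonality_attained\<close> below.\<close>

definition gonality :: "('a, 'b) pre_digraph \<Rightarrow> int" where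
  "gonality G = (LEAST d. \<exists>D. is_divisor G D \<and> positive_rank G D \<and> divisor_degree G D = d)"

lemma (in fin_digraph) degree_fire:
  assumes "v \<in> verts G"
  shows "divisor_degree G (fire G v D) = divisor_degree G D"
proof -
  have fin: "finite (out_arcs G v)" by (rule finite_out_arcs)
  have head: "head G ` out_arcs G v \<subseteq> verts G" by auto
  have "(\<Sum>u \<in> verts G. card {e \<in> out_arcs G v. head G e = u}) = card (out_arcs G v)"
    using sum.group[OF fin finite_verts head, of "\<lambda>_. 1 :: nat"]
    by (simp del: in_out_arcs_conv)
  then have "(\<Sum>u \<in> verts G. int (card {e \<in> out_arcs G v. head G e = u})) = int (out_degree G v)"
    by (metis of_nat_sum out_degree_def)
  then show ?thesis
    using assms by (simp add: divisor_degree_def fire_def sum.distrib sum_subtractf)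
qed

lemma (in fin_digraph) degree_equivalent:
  assumes "equivalent G D D'"
  shows "divisor_degree G D' = divisor_degree G D"
  using assms unfolding equivalent_def
  by (induction rule: rtranclp_induct) (auto simp: fires_to_def degree_fire)

lemma (in fin_digraph) degree_positive_rank:
  assumes "verts G \<noteq> {}" "positive_rank G D"
  shows "divisor_degree G D \<ge> 1"
proof -
  obtain q where q: "q \<in> verts G" using assms by auto
  then obtain E where E: "effective G E" "equivalent G (D(q := D q - 1)) E"
    using assms(2) by (auto simp: positive_rank_def)
  have "0 \<le> divisor_degree G E"
    using E(1) by (auto simp: divisor_degree_def effective_def intro: sum_nonneg)
  also have "\<dots> = divisor_degree G (D(q := D q - 1))"
    using degree_equivalent[OF E(2)] .
  also have "\<dots> = divisor_degree G D - 1"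
    using q by (simp add: divisor_degree_def sum.remove[of "verts G" q])
  finally show ?thesis by simp
qed

lemma (in fin_digraph) gonality_attained:
  assumes "verts G \<noteq> {}"
  shows "\<exists>D. is_divisor G D \<and> positive_rank G D \<and> divisor_degree G D = gonality G"
    and "is_divisor G D \<Longrightarrow> positive_rank G D \<Longrightarrow> gonality G \<le> divisor_degree G D"
proof -
  define P where "P d \<longleftrightarrow> (\<exists>D. is_divisor G D \<and> positive_rank G D \<and> divisor_degree G D = d)" for d
  define D1 :: "'a \<Rightarrow> int" where "D1 v = of_bool (v \<in> verts G)" for v
  have div: "is_divisor G D1" by (simp add: is_divisor_def D1_def)
  have "positive_rank G D1"
    unfolding positive_rank_def
  proof
    fix q assume "q \<in> verts G"
    then have "is_divisor G (D1(q := D1 q - 1)) \<and> effective G (D1(q := D1 q - 1))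
        \<and> equivalent G (D1(q := D1 q - 1)) (D1(q := D1 q - 1))"
      by (auto simp: is_divisor_def D1_def effective_def equivalent_def)
    then show "\<exists>E. is_divisor G E \<and> effective G E \<and> equivalent G (D1(q := D1 q - 1)) E" by blast
  qed
  with div have "P (divisor_degree G D1)" by (auto simp: P_def)
  moreover have ge: "d \<ge> 1" if "P d" for d
    using that degree_positive_rank[OF assms] by (auto simp: P_def)
  ultimately have ex: "P (int (nat (divisor_degree G D1)))"
    by fastforce
  define m where "m = (LEAST k. P (int k))"
  have m: "P (int m)" unfolding m_def using ex by (rule LeastI)
  have le: "int m \<le> d" if "P d" for d
  proof -
    from ge[OF that] have "0 \<le> d" by simp
    then obtain k where k: "d = int k" by (rule nonneg_int_cases)
    then have "m \<le> k" unfolding m_def using that by (auto intro: Least_le)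
    then show ?thesis using k by simp
  qed
  have gon: "gonality G = int m"
    unfolding gonality_def P_def[symmetric] using m le by (rule Least_equality)
  show "\<exists>D. is_divisor G D \<and> positive_rank G D \<and> divisor_degree G D = gonality G"
    using m by (simp add: gon P_def)
  show "gonality G \<le> divisor_degree G D" if "is_divisor G D" "positive_rank G D"
    using le that by (auto simp: gon P_def)
qed


section \<open>Circulant graphs\<close>

text \<open>
  Indices are taken modulo \<open>n\<close>: for \<open>J \<subseteq> {1..n div 2}\<close>, \<open>i\<close> and \<open>m\<close> are adjacent iff one of
  the residues of \<open>\<plusminus>(i - m)\<close> modulo \<open>n\<close> lies in \<open>J\<close>.  If \<open>n\<close> is even and \<open>n div 2 \<in> J\<close>,
  opposite vertices are joined by a single edge.
\<close>

definition circulant_adj :: "nat \<Rightarrow> nat set \<Rightarrow> nat \<Rightarrow> nat \<Rightarrow> bool" where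
  "circulant_adj n J i m \<longleftrightarrow>
     (\<exists>j \<in> J. int j = (int i - int m) mod int n \<or> int j = (int m - int i) mod int n)"

definition circulant :: "nat \<Rightarrow> nat set \<Rightarrow> (nat, nat \<times> nat) pre_digraph" where
  "circulant n J =
     \<lparr>verts = {1..n},
      arcs = {(i, m). i \<in> {1..n} \<and> m \<in> {1..n} \<and> circulant_adj n J i m},
      tail = fst, head = snd\<rparr>"

lemma graph_circulant:
  assumes "J \<subseteq> {1..n div 2}"
  shows "graph (circulant n J)"
proof
  show "finite (arcs (circulant n J))"
    by (rule finite_subset[of _ "{1..n} \<times> {1..n}"]) (auto simp: circulant_def)
  show "symmetric (circulant n J)"
    by (auto simp: symmetric_conv circulant_def circulant_adj_def)
qed (use assms in \<open>auto simp: circulant_def circulant_adj_def arc_to_ends_def\<close>)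

end

(* Let kappa i be the push-forward to Z/n of the divisor on Z with max(0, j - |x - i|) chips on x, summed over
   j in J; it has degree the sum of the j^2.  Second differences of kappa in i are the Laplacian, so
   firing i turns 2 kappa i into kappa (i - 1) + kappa (i + 1).  Firing the interval [-m, m] therefore
   turns kappa (-m) + kappa m into kappa (-m - 1) + kappa (m + 1), and starting from 2 kappa 0 every
   vertex eventually carries a chip.  The multigraph needed here differs from the simple circulant
   graph only if n = 2j for some j in J; then n <= 2 j^2, and one chip on each vertex suffices. *)

theory Submission
  imports Defs
begin

section \<open>The bound by the number of vertices\<close>

lemma (in fin_digraph) gonality_le_card_verts:
  assumes "verts G \<noteq> {}"
  shows "gonality G \<le> int (card (verts G))"
proof -
  define D :: "'a \<Rightarrow> int" where "D v = of_bool (v \<in> verts G)" for v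
  have div: "is_divisor G D" by (simp add: is_divisor_def D_def)
  have "positive_rank G D"
    unfolding positive_rank_def
  proof
    fix q assume "q \<in> verts G"
    then have "is_divisor G (D(q := D q - 1)) \<and> effective G (D(q := D q - 1))
        \<and> equivalent G (D(q := D q - 1)) (D(q := D q - 1))"
      by (auto simp: is_divisor_def D_def effective_def equivalent_def)
    then show "\<exists>E. is_divisor G E \<and> effective G E \<and> equivalent G (D(q := D q - 1)) E" by blast
  qed
  from gonality_attained(2)[OF assms div this] show ?thesis
    by (simp add: divisor_degree_def D_def)
qed

section \<open>Circulant graphs indexed by residues\<close>

text \<open>Vertices are numbered from 1, so the representative of a residue class is taken in
  \<open>{1..n}\<close>; index 0 is vertex \<open>n\<close>.\<close>

definition circ_vertex :: "nat \<Rightarrow> int \<Rightarrow> nat" where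
  "circ_vertex n i = Suc (nat ((i - 1) mod int n))"

lemma circ_vertex_in: "n > 0 \<Longrightarrow> circ_vertex n i \<in> {1..n}"
  by (simp add: circ_vertex_def Suc_le_eq nat_less_iff)

lemma circ_vertex_int: "v \<in> {1..n} \<Longrightarrow> circ_vertex n (int v) = v"
  by (auto simp: circ_vertex_def)

lemma int_circ_vertex_mod: "n > 0 \<Longrightarrow> int (circ_vertex n i) mod int n = i mod int n"
  by (simp add: circ_vertex_def) (metis add.commute diff_add_cancel mod_add_right_eq)

lemma circ_vertex_eq_iff:
  "n > 0 \<Longrightarrow> circ_vertex n i = circ_vertex n k \<longleftrightarrow> i mod int n = k mod int n"
  by (metis circ_vertex_def int_circ_vertex_mod mod_diff_left_eq)

text \<open>The symmetric connection set, kept as integers: for n = 2j the steps j and -j differ but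
  lead to the same vertex.\<close>

definition circ_steps :: "nat set \<Rightarrow> int set" where
  "circ_steps J = int ` J \<union> (\<lambda>j. - int j) ` J"

lemma out_arcs_circulant:
  assumes "n > 0" "J \<subseteq> {1..n div 2}"
  shows "out_arcs (circulant n J) (circ_vertex n i)
    = (\<lambda>d. (circ_vertex n i, circ_vertex n (i + d))) ` circ_steps J" (is "?A = ?B")
proof
  \<comment> \<open>Elements of \<open>J\<close> are their own residues, so the equations in
    \<open>circulant_adj\<close> amount to congruences.\<close>
  have small: "int j mod int n = int j" if "j \<in> J" for j
    using assms that by force
  have res: "(int (circ_vertex n x) - int (circ_vertex n y)) mod int n = (x - y) mod int n" for x y
    using int_circ_vertex_mod[OF assms(1)] by (metis mod_diff_eq)
  show "?A \<subseteq> ?B"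
  proof
    fix e assume "e \<in> ?A"
    then obtain w where e: "e = (circ_vertex n i, w)" "w \<in> {1..n}"
      and adj: "circulant_adj n J (circ_vertex n i) w"
      by (auto simp: circulant_def)
    have w: "circ_vertex n (int w) = w" using circ_vertex_int e(2) .
    from adj obtain j where j: "j \<in> J"
      "int j = (int (circ_vertex n i) - int w) mod int n \<or> int j = (int w - int (circ_vertex n i)) mod int n"
      by (auto simp: circulant_adj_def)
    then have "int j = (i - int w) mod int n \<or> int j = (int w - i) mod int n"
      using res[of i "int w"] res[of "int w" i] by (simp add: w)
    then have "int w mod int n = (i + (- int j)) mod int n \<or> int w mod int n = (i + int j) mod int n"
      by (metis add_diff_cancel_left' diff_add_cancel diff_conv_add_uminus diff_diff_eq2 mod_add_right_eq mod_diff_right_eq)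
    then have "w = circ_vertex n (i + (- int j)) \<or> w = circ_vertex n (i + int j)"
      using circ_vertex_eq_iff[OF assms(1)] w by metis
    then show "e \<in> ?B"
      using j(1) unfolding e circ_steps_def by blast
  qed
  show "?B \<subseteq> ?A"
  proof
    fix e assume "e \<in> ?B"
    then obtain d where d: "d \<in> circ_steps J" and e: "e = (circ_vertex n i, circ_vertex n (i + d))"
      by auto
    have "circulant_adj n J (circ_vertex n i) (circ_vertex n (i + d))"
      using d small unfolding circulant_adj_def res circ_steps_def by force
    then show "e \<in> ?A"
      using circ_vertex_in[OF assms(1)] by (simp add: e circulant_def)
  qed
qed

text \<open>All steps are below n/2 in absolute value, so two of them differ by less than n and
  cannot be congruent unless equal.\<close>

lemma inj_on_circ_steps:
  assumes "n > 0" "\<forall>j\<in>J. 2 * j < n"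
  shows "inj_on (\<lambda>d. circ_vertex n (i + d)) (circ_steps J)"
proof (rule inj_onI)
  fix d d' assume d: "d \<in> circ_steps J" "d' \<in> circ_steps J"
    and eq: "circ_vertex n (i + d) = circ_vertex n (i + d')"
  have bd: "\<bar>2 * x\<bar> < int n" if "x \<in> circ_steps J" for x
    using that assms(2) by (force simp: circ_steps_def)
  have "int n dvd (i + d) - (i + d')"
    using eq circ_vertex_eq_iff[OF assms(1)] mod_eq_dvd_iff by blast
  then have "int n dvd d - d'" by simp
  moreover have "\<bar>d - d'\<bar> < int n" using bd[OF d(1)] bd[OF d(2)] by linarith
  ultimately show "d = d'" using dvd_imp_le_int[of "d - d'" "int n"] by auto
qed

lemma sum_circ_steps:
  fixes f :: "int \<Rightarrow> int"
  assumes "finite J" "0 \<notin> J"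
  shows "(\<Sum>d\<in>circ_steps J. f d) = (\<Sum>j\<in>J. f (int j) + f (- int j))"
proof -
  have "int ` J \<inter> (\<lambda>j. - int j) ` J = {}" using assms(2) by (auto simp: image_iff) (metis of_nat_eq_0_iff neg_equal_zero neg_0_le_iff_le of_nat_0_le_iff order_antisym)
  then have "(\<Sum>d\<in>circ_steps J. f d) = sum f (int ` J) + sum f ((\<lambda>j. - int j) ` J)"
    unfolding circ_steps_def using assms(1) by (intro sum.union_disjoint) auto
  then show ?thesis by (simp add: sum.reindex inj_on_def sum.distrib)
qed

text \<open>Distinct steps give distinct neighbours, so the degree is 2|J|. Pairing j with -j writes
  the Laplacian as a sum of second differences of step j.\<close>

lemma fire_circulant:
  assumes "n > 0" "J \<subseteq> {1..n div 2}" "\<forall>j\<in>J. 2 * j < n"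
  shows "fire (circulant n J) (circ_vertex n i) D u = D u
    + (\<Sum>j\<in>J. of_bool (circ_vertex n (i + int j) = u) + of_bool (circ_vertex n (i - int j) = u)
        - 2 * of_bool (circ_vertex n i = u))"
proof -
  let ?A = "out_arcs (circulant n J) (circ_vertex n i)"
  have fin: "finite J" using assms(2) finite_subset by blast
  then have fin': "finite (circ_steps J)" by (simp add: circ_steps_def)
  have zero: "0 \<notin> J" using assms(2) by auto
  have inj: "inj_on (\<lambda>d. (circ_vertex n i, circ_vertex n (i + d))) (circ_steps J)"
    using inj_on_circ_steps[OF assms(1,3)] by (simp add: inj_on_def)
  note A = out_arcs_circulant[OF assms(1,2)]
  have "int (out_degree (circulant n J) (circ_vertex n i)) = int (card (circ_steps J))"
    by (simp add: out_degree_def A card_image[OF inj])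
  also have "\<dots> = (\<Sum>d\<in>circ_steps J. 1)" by simp
  also have "\<dots> = (\<Sum>j\<in>J. 2)" using sum_circ_steps[OF fin zero, of "\<lambda>_. 1"] by simp
  finally have deg: "int (out_degree (circulant n J) (circ_vertex n i)) = (\<Sum>j\<in>J. 2)" .
  have "{e \<in> ?A. head (circulant n J) e = u}
      = (\<lambda>d. (circ_vertex n i, circ_vertex n (i + d))) ` {d \<in> circ_steps J. circ_vertex n (i + d) = u}"
    unfolding A by (auto simp: circulant_def)
  then have "int (card {e \<in> ?A. head (circulant n J) e = u})
      = int (card {d \<in> circ_steps J. circ_vertex n (i + d) = u})"
    by (metis (no_types, lifting) card_image inj inj_on_subset mem_Collect_eq subsetI)
  also have "\<dots> = (\<Sum>d\<in>circ_steps J. of_bool (circ_vertex n (i + d) = u))"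
    using fin' by (simp add: Int_def)
  also have "\<dots> = (\<Sum>j\<in>J. of_bool (circ_vertex n (i + int j) = u) + of_bool (circ_vertex n (i - int j) = u))"
    using sum_circ_steps[OF fin zero] by simp
  finally show ?thesis
    unfolding fire_def deg by (auto simp: sum_subtractf)
qed

section \<open>Tents and their second differences\<close>

text \<open>The difference of two uniform variables on \<open>{..<j}\<close> has the triangular distribution, which
  gives the profile \<open>max 0 (j - \<bar>x - i\<bar>)\<close>; in this form its second difference telescopes.\<close>

definition tent :: "nat \<Rightarrow> nat set \<Rightarrow> int \<Rightarrow> nat \<Rightarrow> int" where
  "tent n J i u =
     (\<Sum>j\<in>J. \<Sum>s<j. \<Sum>t<j. of_bool (circ_vertex n (i + int s - int t) = u))"

text \<open>Each of the two unit differences telescopes along one of the two summation variables,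
  leaving a second difference of step j.\<close>

lemma second_difference_tent:
  fixes h :: "int \<Rightarrow> int" and j :: nat
  defines "T \<equiv> \<lambda>i. \<Sum>s<j. \<Sum>t<j. h (i + int s - int t)"
  shows "T (i + 1) + T (i - 1) - 2 * T i = h (i + int j) + h (i - int j) - 2 * h i"
proof -
  have up: "T (a + 1) - T a = (\<Sum>t<j. h (a + int j - int t) - h (a - int t))" for a
  proof -
    \<comment> \<open>Raising \<open>a\<close> by 1 has the same effect as raising \<open>s\<close>
      by 1.\<close>
    have "T (a + 1) - T a
        = (\<Sum>t<j. \<Sum>s<j. h (a + int (Suc s) - int t) - h (a + int s - int t))"
      unfolding T_def by (subst (1 2) sum.swap) (simp add: sum_subtractf algebra_simps)
    also have "\<dots> = (\<Sum>t<j. h (a + int j - int t) - h (a + int 0 - int t))"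
      by (intro sum.cong refl sum_lessThan_telescope)
    finally show ?thesis by simp
  qed
  have "T (i + 1) + T (i - 1) - 2 * T i = (T (i + 1) - T i) - (T (i - 1 + 1) - T (i - 1))"
    by simp
  \<comment> \<open>Lowering \<open>i\<close> by 1 has the same effect as raising \<open>t\<close>
    by 1.\<close>
  also have "\<dots> = (\<Sum>t<j. (h (i - int (Suc t)) - h (i - int t))
                      - (h (i + int j - int (Suc t)) - h (i + int j - int t)))"
    unfolding up by (simp flip: sum_subtractf add: algebra_simps)
  also have "\<dots> = (h (i - int j) - h (i - int 0)) - (h (i + int j - int j) - h (i + int j - int 0))"
    unfolding sum_subtractf[of "\<lambda>t. h (i - int (Suc t)) - h (i - int t)"]
    by (simp only: sum_lessThan_telescope[of "\<lambda>t. h (i - int t)"]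
        sum_lessThan_telescope[of "\<lambda>t. h (i + int j - int t)"])
  finally show ?thesis by simp
qed

text \<open>Under firing, tents move as single chips do on a cycle.\<close>

lemma fire_tent:
  assumes "n > 0" "J \<subseteq> {1..n div 2}" "\<forall>j\<in>J. 2 * j < n"
  shows "fire (circulant n J) (circ_vertex n i) D
    = (\<lambda>u. D u + tent n J (i + 1) u + tent n J (i - 1) u - 2 * tent n J i u)"
proof
  fix u
  show "fire (circulant n J) (circ_vertex n i) D u
    = D u + tent n J (i + 1) u + tent n J (i - 1) u - 2 * tent n J i u"
    unfolding fire_circulant[OF assms] tent_def
      second_difference_tent[of "\<lambda>x. of_bool (circ_vertex n x = u)", symmetric]
    by (simp add: sum_subtractf sum.distrib sum_distrib_left)
qed

section \<open>Moving tents by firing intervals\<close>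

text \<open>Firing \<open>a\<close>, ..., \<open>a + k\<close> in turn adds second differences that
  telescope to the two ends. The interval may wrap around, firing some vertices repeatedly.\<close>

lemma equivalent_fire_interval:
  assumes "n > 0" "J \<subseteq> {1..n div 2}" "\<forall>j\<in>J. 2 * j < n"
  shows "equivalent (circulant n J) D
    (\<lambda>u. D u + tent n J (a + int k + 1) u - tent n J (a + int k) u
           - tent n J a u + tent n J (a - 1) u)"
proof (induction k)
  case 0
  have "fires_to (circulant n J) D (fire (circulant n J) (circ_vertex n a) D)"
    using circ_vertex_in[OF assms(1)] by (auto simp: fires_to_def circulant_def)
  then show ?case
    unfolding equivalent_def fire_tent[OF assms]
    by (auto intro!: r_into_rtranclp simp: algebra_simps)
next
  case (Suc k)
  let ?E = "\<lambda>u. D u + tent n J (a + int k + 1) u - tent n J (a + int k) u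
           - tent n J a u + tent n J (a - 1) u"
  have "fires_to (circulant n J) ?E (fire (circulant n J) (circ_vertex n (a + int k + 1)) ?E)"
    using circ_vertex_in[OF assms(1)] by (auto simp: fires_to_def circulant_def)
  with Suc show ?case
    unfolding equivalent_def fire_tent[OF assms]
    by (auto intro: rtranclp.rtrancl_into_rtrancl simp: algebra_simps)
qed

text \<open>The bystander \<open>R\<close> leaves room for the chip removed in the definition of
  rank.\<close>

lemma equivalent_tents:
  assumes "n > 0" "J \<subseteq> {1..n div 2}" "\<forall>j\<in>J. 2 * j < n"
  shows "equivalent (circulant n J) (\<lambda>u. R u + 2 * tent n J 0 u)
    (\<lambda>u. R u + tent n J (int m) u + tent n J (- int m) u)"
proof (induction m)
  case 0
  then show ?case by (simp add: equivalent_def add.commute)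
next
  case (Suc m)
  have comm: "- 1 - int m = - int m - 1" by simp
  have "equivalent (circulant n J) (\<lambda>u. R u + tent n J (int m) u + tent n J (- int m) u)
    (\<lambda>u. R u + tent n J (int (Suc m)) u + tent n J (- int (Suc m)) u)"
    \<comment> \<open>The interval from \<open>- int m\<close> to \<open>int m\<close> has 2m + 1
      indices, hence \<open>k = 2 * m\<close>.\<close>
    using equivalent_fire_interval[OF assms,
        of "\<lambda>u. R u + tent n J (int m) u + tent n J (- int m) u" "- int m" "2 * m"]
    by (simp add: algebra_simps comm)
  with Suc show ?case
    unfolding equivalent_def by (rule rtranclp_trans)
qed

lemma tent_nonneg: "tent n J i u \<ge> 0"
  by (simp add: tent_def sum_nonneg)

lemma tent_outside: "n > 0 \<Longrightarrow> u \<notin> {1..n} \<Longrightarrow> tent n J i u = 0"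
  using circ_vertex_in by (fastforce simp: tent_def intro!: sum.neutral)

text \<open>The summand \<open>s = t = 0\<close> of a single \<open>j\<close> already puts a chip on
  the centre.\<close>

lemma tent_apex:
  assumes "finite J" "j \<in> J" "j > 0" "v \<in> {1..n}"
  shows "tent n J (int v) v \<ge> 1"
proof -
  let ?b = "\<lambda>s t. of_bool (circ_vertex n (int v + int s - int t) = v) :: int"
  have "1 = ?b 0 0" using circ_vertex_int[OF assms(4)] by simp
  also have "\<dots> \<le> (\<Sum>t<j. ?b 0 t)" using assms(3) by (intro member_le_sum) auto
  also have "\<dots> \<le> (\<Sum>s<j. \<Sum>t<j. ?b s t)"
    using assms(3) by (intro member_le_sum) (auto intro: sum_nonneg)
  also have "\<dots> \<le> tent n J (int v) v"
    unfolding tent_def using assms(1,2) by (intro member_le_sum) (auto intro: sum_nonneg)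
  finally show ?thesis .
qed

text \<open>Each of the j^2 pairs \<open>(s, t)\<close> puts exactly one chip on some vertex, even
  where the tent wraps onto itself.\<close>

lemma sum_tent:
  assumes "n > 0"
  shows "(\<Sum>u\<in>{1..n}. tent n J i u) = (\<Sum>j\<in>J. (int j)\<^sup>2)"
proof -
  have one: "(\<Sum>u\<in>{1..n}. of_bool (circ_vertex n x = u)) = (1::int)" for x
    using circ_vertex_in[OF assms, of x] by (simp add: of_bool_def)
  have "(\<Sum>u\<in>{1..n}. tent n J i u)
      = (\<Sum>j\<in>J. \<Sum>s<j. \<Sum>t<j. \<Sum>u\<in>{1..n}. of_bool (circ_vertex n (i + int s - int t) = u))"
    unfolding tent_def by (simp only: sum.swap[where A = "{1..n}"])
  then show ?thesis by (simp only: one) (simp add: power2_eq_square)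
qed

section \<open>The gonality bound\<close>

theorem theorem1p1:
  fixes n :: nat and J :: "nat set"
  assumes "n > 0"
    and "J \<noteq> {}" and "J \<subseteq> {1..n div 2}"
    and "Digraph_Component.connected (circulant n J)"
  shows "gonality (circulant n J) \<le> 2 * (\<Sum>j\<in>J. (int j)\<^sup>2)"
proof -
  let ?G = "circulant n J"
  interpret graph ?G using graph_circulant[OF assms(3)] .
  have verts: "verts ?G = {1..n}" by (simp add: circulant_def)
  then have ne: "verts ?G \<noteq> {}" using assms(1) by auto
  have fin: "finite J" using assms(3) finite_subset by blast
  show ?thesis
  proof (cases "\<forall>j\<in>J. 2 * j < n")
    case True
    let ?D = "\<lambda>u. 2 * tent n J 0 u"
    have div: "is_divisor ?G ?D"
      using tent_outside[OF assms(1)] by (simp add: is_divisor_def verts)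
    have "positive_rank ?G ?D"
      unfolding positive_rank_def
    proof
      fix q assume "q \<in> verts ?G"
      then have q: "q \<in> {1..n}" by (simp add: verts)
      \<comment> \<open>The debt at \<open>q\<close> stays put while \<open>q\<close> rounds of
        firing bring the apex of one tent there to pay it.\<close>
      let ?R = "\<lambda>u. - of_bool (u = q) :: int"
      let ?E = "\<lambda>u. ?R u + tent n J (int q) u + tent n J (- int q) u"
      have start: "(\<lambda>u. ?R u + 2 * tent n J 0 u) = ?D(q := ?D q - 1)" by auto
      obtain j where "j \<in> J" "j > 0" using assms(2,3) by force
      then have "tent n J (int q) q \<ge> 1" using tent_apex fin q by blast
      then have "effective ?G ?E"
        using tent_nonneg[of n J] by (auto simp: effective_def add_increasing2)
      moreover have "is_divisor ?G ?E"
        using q tent_outside[OF assms(1)] by (auto simp: is_divisor_def verts)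
      moreover have "equivalent ?G (?D(q := ?D q - 1)) ?E"
        using equivalent_tents[OF assms(1,3) True, of ?R q] unfolding start .
      ultimately show "\<exists>E. is_divisor ?G E \<and> effective ?G E \<and> equivalent ?G (?D(q := ?D q - 1)) E"
        by blast
    qed
    moreover have "divisor_degree ?G ?D = 2 * (\<Sum>j\<in>J. (int j)\<^sup>2)"
      by (simp only: divisor_degree_def verts sum_tent[OF assms(1)] flip: sum_distrib_left)
    ultimately show ?thesis using gonality_attained(2)[OF ne div] by simp
  next
    case False
    then obtain j where j: "j \<in> J" "n \<le> 2 * j" by auto
    have "int n \<le> 2 * (int j)\<^sup>2"
      \<comment> \<open>Since n > 0 forces j >= 1, n <= 2j <= 2j^2.\<close>
      using j(2) self_le_power[of "int j" 2] assms(1) by linarith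
    also have "\<dots> \<le> 2 * (\<Sum>j\<in>J. (int j)\<^sup>2)"
      using member_le_sum[OF j(1), of "\<lambda>j. (int j)\<^sup>2"] fin by simp
    finally show ?thesis
      using gonality_le_card_verts[OF ne] by (simp add: verts)
  qed
qed

end
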